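(* Let $A,B,C$ be qubit systems, let $A',B',C'$ be quantum systems of arbitrary dimensions, and let $\rho$ be a secret-sharing state on $ABCA'B'C'$ for 3-party secret sharing, where the three parties hold $AA'$, $BB'$ and $CC'$ respectively. Then $\rho$ is bipartite distillable for all bipartite splits of the three parties, i.e. for each of the splits $AA'$-$BB'CC'$, $BB'$-$CC'AA'$ and $CC'$-$AA'BB'$.
   Context: A density operator on $ABCA'B'C'$ is a *(3-party) secret-sharing state* if it is of the form $$\frac14\sum_{\substack{i+j+k\equiv 0\ (\mathrm{mod}\ 2)\\ i'+j'+k'\equiv 0\ (\mathrm{mod}\ 2)}} |ijk\rangle\langle i'j'k'|_{ABC}\otimes U_{ijk}\,\rho_{A'B'C'}\,U_{i'j'k'}^{\dagger}$$ for some density operator $\rho_{A'B'C'}$ on $A'B'C'$ and some unitary operators $U_{ijk}$ on $A'B'C'$ (one for each $(i,j,k)\in\{0,1\}^3$ with $i+j+k$ even), the sum being over $i,j,k,i',j',k'\in\{0,1\}$ satisfying the parity conditions. For a split of the parties into two groups, regard $\rho$ as a bipartite state in which each group acts as a single laboratory (arbitrary joint operations are allowed within a group). A bipartite state is *(bipartite) distillable* if, from sufficiently many copies of it, local operations and classical communication (LOCC) between the two laboratories can produce, with nonzero probability, a two-qubit state with fidelity arbitrarily close to 1 with the maximally entangled state $\frac{1}{\sqrt2}(|00\rangle+|11\rangle)$. *)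

theory Defs
  imports "Jordan_Normal_Form.Schur_Decomposition"
begin

definition psd :: "nat \<Rightarrow> complex mat \<Rightarrow> bool" where
  "psd d M \<longleftrightarrow> M \<in> carrier_mat d d \<and> mat_adjoint M = M \<and>
     (\<forall>v \<in> carrier_vec d. 0 \<le> (M *\<^sub>v v) \<bullet>c v)"

definition mat_trace :: "complex mat \<Rightarrow> complex" where
  "mat_trace M = (\<Sum>i<dim_row M. M $$ (i, i))"

definition density_operator :: "nat \<Rightarrow> complex mat \<Rightarrow> bool" where
  "density_operator d \<rho> \<longleftrightarrow> psd d \<rho> \<and> mat_trace \<rho> = 1"

definition unitary_op :: "nat \<Rightarrow> complex mat \<Rightarrow> bool" where
  "unitary_op d U \<longleftrightarrow> U \<in> carrier_mat d d \<and>
     mat_adjoint U * U = 1\<^sub>m d \<and> U * mat_adjoint U = 1\<^sub>m d"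

text \<open>The type of matrices has no additive monoid instance, so the dimension \<open>d\<close> of the
  summands is a parameter.\<close>

definition mat_sum :: "nat \<Rightarrow> ('i \<Rightarrow> complex mat) \<Rightarrow> 'i set \<Rightarrow> complex mat" where
  "mat_sum d f I = mat d d (\<lambda>rc. \<Sum>i\<in>I. f i $$ rc)"

definition ketbra :: "nat \<Rightarrow> nat \<Rightarrow> nat \<Rightarrow> complex mat" where
  "ketbra d i j = mat d d (\<lambda>(r, c). if r = i \<and> c = j then 1 else 0)"

definition kron :: "complex mat \<Rightarrow> complex mat \<Rightarrow> complex mat" (infixr "\<otimes>\<^sub>k" 73) where
  "A \<otimes>\<^sub>k B = mat (dim_row A * dim_row B) (dim_col A * dim_col B)
     (\<lambda>(r, c). A $$ (r div dim_row B, c div dim_col B) * B $$ (r mod dim_row B, c mod dim_col B))"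

text \<open>The basis vector \<open>|x\<^sub>0 x\<^sub>1 \<dots> x\<^sub>m\<rangle>\<close> of a tensor product of spaces of dimensions
  \<open>ds = [d\<^sub>0, \<dots>, d\<^sub>m]\<close> has the index with mixed-radix digits \<open>x\<^sub>0, \<dots>, x\<^sub>m\<close>, the leftmost
  digit being the most significant; this agrees with the indexing of \<open>\<otimes>\<^sub>k\<close>. The value of the digit
  at position \<open>k\<close> is multiplied by \<open>weight ds k\<close>.\<close>

definition weight :: "nat list \<Rightarrow> nat \<Rightarrow> nat" where
  "weight ds k = prod_list (drop (Suc k) ds)"

definition digit :: "nat list \<Rightarrow> nat \<Rightarrow> nat \<Rightarrow> nat" where
  "digit ds r k = (r div weight ds k) mod (ds ! k)"

text \<open>\<open>permute_systems ds p M\<close> is the operator \<open>M\<close>, which acts on tensor factors of dimensions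
  \<open>ds\<close>, with its factors reordered: the factor at the new position \<open>l\<close> is the one at the old
  position \<open>p ! l\<close>. The function \<open>permute_index\<close> sends the new index of a basis vector to its
  old index.\<close>

definition permute_index :: "nat list \<Rightarrow> nat list \<Rightarrow> nat \<Rightarrow> nat" where
  "permute_index ds p r =
     (\<Sum>l<length p. digit (map (\<lambda>k. ds ! k) p) r l * weight ds (p ! l))"

definition permute_systems :: "nat list \<Rightarrow> nat list \<Rightarrow> complex mat \<Rightarrow> complex mat" where
  "permute_systems ds p M = mat (prod_list ds) (prod_list ds)
     (\<lambda>(r, c). M $$ (permute_index ds p r, permute_index ds p c))"

text \<open>The tensor factors are ordered \<open>A, B, C, A', B', C'\<close>, where \<open>A, B, C\<close> are qubits and
  \<open>A', B', C'\<close> have dimensions \<open>a, b, c\<close>.\<close>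

definition even_triples :: "(nat \<times> nat \<times> nat) set" where
  "even_triples = {(i, j, k). i \<in> {0, 1} \<and> j \<in> {0, 1} \<and> k \<in> {0, 1} \<and> even (i + j + k)}"

definition secret_sharing_state :: "nat \<Rightarrow> nat \<Rightarrow> nat \<Rightarrow> complex mat \<Rightarrow> bool" where
  "secret_sharing_state a b c \<rho> \<longleftrightarrow>
     density_operator (2 * 2 * 2 * a * b * c) \<rho> \<and>
     (\<exists>\<rho>' U. density_operator (a * b * c) \<rho>' \<and>
        (\<forall>t \<in> even_triples. unitary_op (a * b * c) (U t)) \<and>
        \<rho> = (1/4) \<cdot>\<^sub>m mat_sum (2 * 2 * 2 * a * b * c)
          (\<lambda>((i, j, k), (i', j', k')).
             (ketbra 2 i i' \<otimes>\<^sub>k ketbra 2 j j' \<otimes>\<^sub>k ketbra 2 k k') \<otimes>\<^sub>k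
             (U (i, j, k) * \<rho>' * mat_adjoint (U (i', j', k'))))
          (even_triples \<times> even_triples))"

text \<open>A local measurement is a finite list of Kraus operators, one per outcome. Output dimensions
  are arbitrary, so adding ancillas and discarding subsystems are included.\<close>

definition instrument :: "nat \<Rightarrow> complex mat list \<Rightarrow> bool" where
  "instrument d Ks \<longleftrightarrow> (\<forall>K \<in> set Ks. dim_col K = d) \<and>
     mat_sum d (\<lambda>m. mat_adjoint (Ks ! m) * (Ks ! m)) {..<length Ks} = 1\<^sub>m d"

text \<open>\<open>locc dA dB bs\<close>: some finite two-way LOCC protocol starting with laboratories of dimensions
  \<open>dA\<close> and \<open>dB\<close> has the list of branches \<open>bs\<close>, one for each complete record of announced
  outcomes, where \<open>(X, Y)\<close> stands for the accumulated Kraus operator \<open>X \<otimes> Y\<close>. Every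
  branch is extended independently of the others, i.e. the next measurement may depend on all
  previous outcomes.\<close>

inductive locc :: "nat \<Rightarrow> nat \<Rightarrow> (complex mat \<times> complex mat) list \<Rightarrow> bool"
  for dA dB :: nat where
  start: "locc dA dB [(1\<^sub>m dA, 1\<^sub>m dB)]"
| first_lab: "locc dA dB (bs @ (X, Y) # bs') \<Longrightarrow> instrument (dim_row X) Ks \<Longrightarrow>
    locc dA dB (bs @ map (\<lambda>K. (K * X, Y)) Ks @ bs')"
| second_lab: "locc dA dB (bs @ (X, Y) # bs') \<Longrightarrow> instrument (dim_row Y) Ks \<Longrightarrow>
    locc dA dB (bs @ map (\<lambda>K. (X, K * Y)) Ks @ bs')"

text \<open>\<open>\<sigma>\<close> is the normalised two-qubit state held when the protocol ends in one of the branches in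
  the set \<open>S\<close> (only the membership in \<open>S\<close> being remembered), an event whose probability
  \<open>mat_trace \<tau>\<close> is required to be nonzero. Summing over \<open>S\<close> accounts for discarded information
  and hence for local operations with several Kraus operators per outcome.\<close>

definition locc_obtainable :: "nat \<Rightarrow> nat \<Rightarrow> complex mat \<Rightarrow> complex mat \<Rightarrow> bool" where
  "locc_obtainable dA dB \<rho> \<sigma> \<longleftrightarrow>
     (\<exists>bs S \<tau>. locc dA dB bs \<and> S \<subseteq> {..<length bs} \<and>
        (\<forall>m \<in> S. dim_row (fst (bs ! m)) = 2 \<and> dim_row (snd (bs ! m)) = 2) \<and>
        \<tau> = mat_sum 4 (\<lambda>m. (fst (bs ! m) \<otimes>\<^sub>k snd (bs ! m)) * \<rho> *
                           mat_adjoint (fst (bs ! m) \<otimes>\<^sub>k snd (bs ! m))) S \<and>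
        mat_trace \<tau> \<noteq> 0 \<and> \<sigma> = (1 / mat_trace \<tau>) \<cdot>\<^sub>m \<tau>)"

text \<open>\<open>n\<close> copies of a bipartite operator, with the first subsystems of all copies collected in
  the first factor (dimension \<open>dA ^ n\<close>) and the second ones in the second factor (dimension
  \<open>dB ^ n\<close>).\<close>

fun copies :: "nat \<Rightarrow> nat \<Rightarrow> complex mat \<Rightarrow> nat \<Rightarrow> complex mat" where
  "copies dA dB \<rho> 0 = 1\<^sub>m 1"
| "copies dA dB \<rho> (Suc n) =
     permute_systems [dA, dB, dA ^ n, dB ^ n] [0, 2, 1, 3] (\<rho> \<otimes>\<^sub>k copies dA dB \<rho> n)"

definition max_entangled :: "complex vec" where
  "max_entangled = complex_of_real (1 / sqrt 2) \<cdot>\<^sub>v (unit_vec 4 0 + unit_vec 4 3)"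

text \<open>Fidelity with a pure state, in the convention \<open>\<langle>\<psi>|\<sigma>|\<psi>\<rangle>\<close>.\<close>

definition fidelity_pure :: "complex mat \<Rightarrow> complex vec \<Rightarrow> real" where
  "fidelity_pure \<sigma> \<psi> = Re ((\<sigma> *\<^sub>v \<psi>) \<bullet>c \<psi>)"

definition distillable :: "nat \<Rightarrow> nat \<Rightarrow> complex mat \<Rightarrow> bool" where
  "distillable dA dB \<rho> \<longleftrightarrow>
     (\<forall>\<epsilon>>0. \<exists>n \<sigma>. locc_obtainable (dA ^ n) (dB ^ n) (copies dA dB \<rho> n) \<sigma> \<and>
        fidelity_pure \<sigma> max_entangled > 1 - \<epsilon>)"

end

theory Submission
  imports Defs
begin

text \<open>A secret-sharing state has an entry \<open>q \<noteq> 0\<close> between two basis vectors with qubit labels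
  \<open>000\<close> and \<open>101\<close> (or any other pair of even triples), because \<open>U\<^sub>0\<^sub>0\<^sub>0 \<rho>' U\<^sub>1\<^sub>0\<^sub>1\<^sup>\<dagger> \<noteq> 0\<close>. If the triples
  differ in the bit held by the first laboratory, exchanging these bits makes the parities odd, so
  projecting each laboratory on its two basis vectors leaves a matrix
  \<open>p|00\<rangle>\<langle>00| + q|00\<rangle>\<langle>11| + q\<^sup>*|11\<rangle>\<langle>00| + r|11\<rangle>\<langle>11|\<close>, with \<open>2|q| \<le> p + r\<close> by positivity.
  On \<open>n\<close> copies each laboratory maps \<open>|u\<^sub>+\<rangle>\<^sup>\<otimes>\<^sup>n\<close>, \<open>|u\<^sub>-\<rangle>\<^sup>\<otimes>\<^sup>n\<close> to \<open>|0\<rangle>\<close>, \<open>|1\<rangle>\<close>, where \<open>u\<^sub>\<plusminus>\<close> is the sum or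
  difference of its two vectors, up to phases. The fidelity of the result is
  \<open>A\<^sup>n / (A\<^sup>n + B\<^sup>n)\<close> with \<open>A = (p + r + 2|q|) / 4\<close> and \<open>B = (p + r - 2|q|) / 4 < A\<close>.\<close>

section \<open>Entries of adjoints, products and Kronecker products\<close>

lemma mat_adjoint_carrier [simp]: "A \<in> carrier_mat m n \<Longrightarrow> mat_adjoint A \<in> carrier_mat n m"
  by (auto simp: mat_adjoint_def)

lemma dim_mat_adjoint [simp]:
  "dim_row (mat_adjoint A) = dim_col A" "dim_col (mat_adjoint A) = dim_row A"
  by (auto simp: mat_adjoint_def)

lemma index_mat_adjoint [simp]:
  fixes A :: "complex mat"
  assumes "i < dim_col A" "j < dim_row A"
  shows "mat_adjoint A $$ (i, j) = cnj (A $$ (j, i))"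
  using assms by (simp add: mat_adjoint_def mat_of_rows_def)

lemma index_mult_sum:
  assumes "A \<in> carrier_mat m n" "B \<in> carrier_mat n k" "i < m" "j < k"
  shows "(A * B) $$ (i, j) = (\<Sum>l<n. A $$ (i, l) * B $$ (l, j))"
  using assms by (auto simp: scalar_prod_def atLeast0LessThan intro!: sum.cong)

lemma mult_add_less:
  fixes i j m n :: nat
  assumes "i < m" "j < n"
  shows "i * n + j < m * n"
proof -
  have "i * n + j < (i + 1) * n" using assms by simp
  also have "\<dots> \<le> m * n" using assms by (intro mult_right_mono) auto
  finally show ?thesis .
qed

lemma sum_lessThan_mult:
  fixes f :: "nat \<Rightarrow> 'a::comm_monoid_add"
  shows "(\<Sum>k<m * n. f k) = (\<Sum>i<m. \<Sum>j<n. f (i * n + j))"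
proof -
  have "(\<Sum>k<m * n. f k) = (\<Sum>i<m. sum f {i * n..<i * n + n})"
    by (rule sum.nat_group[symmetric])
  also have "\<dots> = (\<Sum>i<m. \<Sum>j<n. f (i * n + j))"
    using sum.shift_bounds_nat_ivl[of f 0 _ n] by (simp add: atLeast0LessThan add.commute[of n] add.commute[of _ "_ * n"])
  finally show ?thesis .
qed

lemma sum_swap_pairs:
  "(\<Sum>k\<in>A. \<Sum>h\<in>B. \<Sum>i\<in>C. \<Sum>j\<in>D. f k h i j) = (\<Sum>i\<in>C. \<Sum>j\<in>D. \<Sum>k\<in>A. \<Sum>h\<in>B. f k h i j)"
  by (simp only: sum.swap[of _ C B] sum.swap[of _ C A] sum.swap[of _ D B] sum.swap[of _ D A])

lemma index_kron:
  assumes "A \<in> carrier_mat m n" "B \<in> carrier_mat m' n'" "i < m" "i' < m'" "j < n" "j' < n'"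
  shows "(A \<otimes>\<^sub>k B) $$ (i * m' + i', j * n' + j') = A $$ (i, j) * B $$ (i', j')"
  using assms mult_add_less[of i m i' m'] mult_add_less[of j n j' n'] by (auto simp: kron_def)

lemma kron_carrier [simp]:
  assumes "A \<in> carrier_mat m n" "B \<in> carrier_mat m' n'"
  shows "A \<otimes>\<^sub>k B \<in> carrier_mat (m * m') (n * n')"
  using assms by (auto simp: kron_def)

lemma dim_kron [simp]:
  "dim_row (A \<otimes>\<^sub>k B) = dim_row A * dim_row B" "dim_col (A \<otimes>\<^sub>k B) = dim_col A * dim_col B"
  by (auto simp: kron_def)

section \<open>Mixed-radix indices and reordered tensor factors\<close>

fun mixed_radix :: "nat list \<Rightarrow> nat list \<Rightarrow> nat" where
  "mixed_radix (d # ds) (x # xs) = x * prod_list ds + mixed_radix ds xs"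
| "mixed_radix _ _ = 0"

lemma mixed_radix_less:
  "list_all2 (<) xs ds \<Longrightarrow> mixed_radix ds xs < prod_list ds"
  by (induction xs ds rule: list_all2_induct) (auto simp: mult_add_less)

lemma weight_Cons [simp]: "weight (d # ds) 0 = prod_list ds" "weight (d # ds) (Suc k) = weight ds k"
  by (simp_all add: weight_def)

lemma weight_dvd: "k < length ds \<Longrightarrow> weight ds k * ds ! k dvd prod_list ds"
proof (induction ds arbitrary: k)
  case (Cons d ds)
  then show ?case by (cases k) auto
qed simp

text \<open>A leading digit contributes a multiple of \<open>weight ds k * ds ! k\<close>. Division
  by the weight leaves a multiple of \<open>ds ! k\<close>, which vanishes in the remainder.\<close>

lemma digit_add_multiple:
  assumes "k < length ds" "weight ds k > 0"
  shows "digit ds (x * prod_list ds + r) k = digit ds r k"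
proof -
  obtain e where e: "prod_list ds = weight ds k * ds ! k * e"
    using weight_dvd[OF assms(1)] by (auto elim: dvdE)
  have "(x * prod_list ds + r) div weight ds k = x * (ds ! k * e) + r div weight ds k"
    using assms(2) by (simp add: e mult.assoc mult.left_commute[of x])
  then show ?thesis by (simp add: digit_def mult.left_commute[of x])
qed

lemma digit_mixed_radix:
  "list_all2 (<) xs ds \<Longrightarrow> k < length ds \<Longrightarrow> digit ds (mixed_radix ds xs) k = xs ! k"
proof (induction xs ds arbitrary: k rule: list_all2_induct)
  case (Cons x xs d ds)
  have less: "mixed_radix ds xs < prod_list ds" by (rule mixed_radix_less[OF Cons(2)])
  then have nz: "prod_list ds \<noteq> 0" by linarith
  show ?case
  proof (cases k)
    case 0
    have "(x * prod_list ds + mixed_radix ds xs) div prod_list ds = x"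
      by (simp only: div_mult_self3[OF nz] div_less[OF less] add_0_right)
    then show ?thesis using 0 Cons(1) by (simp add: digit_def)
  next
    case (Suc j)
    \<comment> \<open>A zero weight would make the whole product zero by
      \<open>weight_dvd\<close>.\<close>
    have "weight ds j \<noteq> 0"
    proof
      assume "weight ds j = 0"
      then have "prod_list ds = 0" using weight_dvd[of j ds] Cons(4) Suc by simp
      then show False using nz by contradiction
    qed
    then have "digit ds (x * prod_list ds + mixed_radix ds xs) j = digit ds (mixed_radix ds xs) j"
      using Cons(4) Suc by (intro digit_add_multiple) auto
    then show ?thesis using Suc Cons by (simp add: digit_def)
  qed
qed simp

text \<open>Once an index is given by its digits in the new order, its old index is an explicit
  polynomial in them, free of \<open>div\<close> and \<open>mod\<close>.\<close>

lemma permute_index_mixed_radix: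
  assumes "list_all2 (<) xs (map (\<lambda>k. ds ! k) p)"
  shows "permute_index ds p (mixed_radix (map (\<lambda>k. ds ! k) p) xs) =
    (\<Sum>l<length p. xs ! l * weight ds (p ! l))"
  unfolding permute_index_def
  by (intro sum.cong refl arg_cong2[where f = "(*)"] digit_mixed_radix assms) simp_all

lemma index_permute_systems:
  assumes "r < prod_list ds" "c < prod_list ds"
  shows "permute_systems ds p M $$ (r, c) = M $$ (permute_index ds p r, permute_index ds p c)"
  using assms by (simp add: permute_systems_def)

lemma permute_systems_carrier: "permute_systems ds p M \<in> carrier_mat (prod_list ds) (prod_list ds)"
  by (simp add: permute_systems_def)

section \<open>Sesquilinear forms on many copies\<close>

text \<open>With \<open>u\<close> and \<open>w\<close> read as rows, this is
  \<open>(u \<otimes> w) M (u' \<otimes> w')\<^sup>\<dagger>\<close>. Only the right-hand pair is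
  conjugated, as in an entry of \<open>N * M * mat_adjoint N\<close>.\<close>

definition product_form ::
  "nat \<Rightarrow> nat \<Rightarrow> complex mat \<Rightarrow> (nat \<Rightarrow> complex) \<Rightarrow> (nat \<Rightarrow> complex) \<Rightarrow> (nat \<Rightarrow> complex) \<Rightarrow>
    (nat \<Rightarrow> complex) \<Rightarrow> complex" where
  "product_form m n M u w u' w' = (\<Sum>i<m. \<Sum>j<n. \<Sum>i'<m. \<Sum>j'<n.
     u i * w j * M $$ (i * n + j, i' * n + j') * cnj (u' i') * cnj (w' j'))"

text \<open>The leading digit of \<open>k\<close> belongs to the newest copy, in agreement with
  \<open>copies\<close>, which puts the new copy in front.\<close>

fun tensor_power :: "nat \<Rightarrow> (nat \<Rightarrow> complex) \<Rightarrow> nat \<Rightarrow> nat \<Rightarrow> complex" where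
  "tensor_power d u 0 k = 1"
| "tensor_power d u (Suc n) k = u (k div d ^ n) * tensor_power d u n (k mod d ^ n)"

text \<open>The sum over \<open>k\<close> splits into sums over its digits and factorises. For
  positive \<open>n\<close>, powers of orthonormal vectors are therefore orthonormal.\<close>

lemma tensor_power_inner:
  "(\<Sum>k<d ^ n. tensor_power d u n k * cnj (tensor_power d v n k)) = (\<Sum>i<d. u i * cnj (v i)) ^ n"
proof (induction n)
  case (Suc n)
  have "(\<Sum>k<d ^ Suc n. tensor_power d u (Suc n) k * cnj (tensor_power d v (Suc n) k)) =
    (\<Sum>i<d. \<Sum>k<d ^ n. (u i * cnj (v i)) * (tensor_power d u n k * cnj (tensor_power d v n k)))"
    unfolding power_Suc sum_lessThan_mult
    by (intro sum.cong refl) (simp add: algebra_simps)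
  then show ?case by (simp add: sum_product[symmetric] Suc)
qed simp

lemma copies_carrier: "copies m n M k \<in> carrier_mat (m ^ k * n ^ k) (m ^ k * n ^ k)"
  by (cases k) (auto simp: permute_systems_def algebra_simps)

text \<open>The digits \<open>i\<close>, \<open>j\<close> belong to the new copy and
  \<open>k\<close>, \<open>h\<close> to the old ones. The permutation turns the order
  \<open>i, k, j, h\<close> into \<open>i, j, k, h\<close>, which is an index of the Kronecker
  product, so the entry factorises.\<close>

lemma index_copies_Suc:
  assumes M: "M \<in> carrier_mat (m * n) (m * n)"
    and "i < m" "k < m ^ l" "j < n" "h < n ^ l" "i' < m" "k' < m ^ l" "j' < n" "h' < n ^ l"
  shows "copies m n M (Suc l) $$ ((i * m ^ l + k) * n ^ Suc l + (j * n ^ l + h),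
      (i' * m ^ l + k') * n ^ Suc l + (j' * n ^ l + h')) =
    M $$ (i * n + j, i' * n + j') * copies m n M l $$ (k * n ^ l + h, k' * n ^ l + h')"
proof -
  let ?ds = "[m, n, m ^ l, n ^ l]" and ?p = "[0, 2, 1, 3] :: nat list"
  have idx: "(i * m ^ l + k) * n ^ Suc l + (j * n ^ l + h) < prod_list ?ds \<and>
     permute_index ?ds ?p ((i * m ^ l + k) * n ^ Suc l + (j * n ^ l + h)) =
     (i * n + j) * (m ^ l * n ^ l) + (k * n ^ l + h)"
    (is "?r < _ \<and> _") if "i < m" "k < m ^ l" "j < n" "h < n ^ l" for i k j h
  proof -
    have v: "list_all2 (<) [i, k, j, h] (map (\<lambda>k. ?ds ! k) ?p)" using that by simp
    have "permute_index ?ds ?p (mixed_radix (map (\<lambda>k. ?ds ! k) ?p) [i, k, j, h]) =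
       (i * n + j) * (m ^ l * n ^ l) + (k * n ^ l + h)"
      by (subst permute_index_mixed_radix[OF v])
        (simp add: weight_def eval_nat_numeral algebra_simps)
    moreover have "mixed_radix (map (\<lambda>k. ?ds ! k) ?p) [i, k, j, h] = ?r" by (simp add: algebra_simps)
    moreover have "mixed_radix (map (\<lambda>k. ?ds ! k) ?p) [i, k, j, h] < prod_list ?ds"
      using mixed_radix_less[OF v] by (simp add: algebra_simps)
    ultimately show ?thesis by metis
  qed
  show ?thesis
    using idx[OF assms(2-5)] idx[OF assms(6-9)] assms
    by (simp add: index_permute_systems index_kron[OF M copies_carrier] mult_add_less del: prod_list.Cons)
qed

text \<open>In the induction step every index splits into a digit for the new copy and a rest. The
  summand is a product of a term in the digits and a term in the rests, so it remains to bring the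
  eight sums into a separable order.\<close>

lemma product_form_copies:
  assumes M: "M \<in> carrier_mat (m * n) (m * n)"
  shows "product_form (m ^ l) (n ^ l) (copies m n M l) (tensor_power m u l) (tensor_power n w l)
    (tensor_power m u' l) (tensor_power n w' l) = product_form m n M u w u' w' ^ l"
proof (induction l)
  case 0
  show ?case by (simp add: product_form_def)
next
  case (Suc l)
  let ?u = "tensor_power m u l" and ?w = "tensor_power n w l"
    and ?u' = "tensor_power m u' l" and ?w' = "tensor_power n w' l"
  let ?N = "copies m n M l"
  have "product_form (m ^ Suc l) (n ^ Suc l) (copies m n M (Suc l)) (tensor_power m u (Suc l))
      (tensor_power n w (Suc l)) (tensor_power m u' (Suc l)) (tensor_power n w' (Suc l)) =
    (\<Sum>i<m. \<Sum>k<m ^ l. \<Sum>j<n. \<Sum>h<n ^ l. \<Sum>i'<m. \<Sum>k'<m ^ l. \<Sum>j'<n. \<Sum>h'<n ^ l.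
      (u i * w j * M $$ (i * n + j, i' * n + j') * cnj (u' i') * cnj (w' j')) *
      (?u k * ?w h * ?N $$ (k * n ^ l + h, k' * n ^ l + h') * cnj (?u' k') * cnj (?w' h')))"
    (is "_ = (\<Sum>i<m. \<Sum>k<m ^ l. \<Sum>j<n. \<Sum>h<n ^ l. \<Sum>i'<m. \<Sum>k'<m ^ l. \<Sum>j'<n. \<Sum>h'<n ^ l.
      ?f i j i' j' * ?g k h k' h')")
    unfolding product_form_def power_Suc sum_lessThan_mult
    by (intro sum.cong refl, subst index_copies_Suc[OF M, unfolded power_Suc]) simp_all
  \<comment> \<open>First \<open>j\<close> moves in front of \<open>k\<close> and \<open>j'\<close>
    in front of \<open>k'\<close>; then the sums over \<open>i'\<close>, \<open>j'\<close> pass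
    those over \<open>k\<close>, \<open>h\<close>.\<close>
  also have "\<dots> = (\<Sum>i<m. \<Sum>j<n. \<Sum>k<m ^ l. \<Sum>h<n ^ l. \<Sum>i'<m. \<Sum>j'<n. \<Sum>k'<m ^ l. \<Sum>h'<n ^ l.
      ?f i j i' j' * ?g k h k' h')"
    by (simp only: sum.swap[of _ "{..<n}" "{..<m ^ l}"])
  also have "\<dots> = (\<Sum>i<m. \<Sum>j<n. \<Sum>i'<m. \<Sum>j'<n. \<Sum>k<m ^ l. \<Sum>h<n ^ l. \<Sum>k'<m ^ l. \<Sum>h'<n ^ l.
      ?f i j i' j' * ?g k h k' h')"
    by (rule sum.cong[OF refl], rule sum.cong[OF refl], rule sum_swap_pairs)
  also have "\<dots> = product_form m n M u w u' w' *
      product_form (m ^ l) (n ^ l) ?N ?u ?w ?u' ?w'"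
    by (simp only: product_form_def sum_distrib_left[symmetric] sum_distrib_right[symmetric])
  finally show ?case by (simp only: Suc power_Suc)
qed

section \<open>Local filtering by coisometries\<close>

text \<open>Since \<open>K\<close> is a coisometry, \<open>P = mat_adjoint K * K\<close> is an
  orthogonal projection. Hence \<open>Q = 1 - P\<close> is one too, and as Kraus operator of the
  failure outcome it contributes \<open>mat_adjoint Q * Q = Q\<close>, which completes
  \<open>P\<close> to the identity.\<close>

lemma instrument_coisometry:
  fixes K :: "complex mat"
  assumes K: "K \<in> carrier_mat k d" and KK: "K * mat_adjoint K = 1\<^sub>m k"
  shows "instrument d [K, 1\<^sub>m d - mat_adjoint K * K]"
proof -
  let ?P = "mat_adjoint K * K" and ?Q = "1\<^sub>m d - mat_adjoint K * K"
  have K': "mat_adjoint K \<in> carrier_mat d k" using K by simp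
  have P: "?P \<in> carrier_mat d d" by (rule mult_carrier_mat[OF K' K])
  have "?P * ?P = mat_adjoint K * ((K * mat_adjoint K) * K)"
    by (simp only: assoc_mult_mat[OF K' K P] assoc_mult_mat[OF K K' K])
  also have "\<dots> = ?P" using K by (simp add: KK)
  finally have PP: "?P * ?P = ?P" .
  \<comment> \<open>In this form exchanging \<open>i\<close> and \<open>j\<close> visibly conjugates
    the entry, which gives self-adjointness of \<open>?Q\<close>.\<close>
  have adj: "mat_adjoint K * K = mat d d (\<lambda>(i, j). \<Sum>l<k. cnj (K $$ (l, i)) * K $$ (l, j))"
    using K by (intro eq_matI) (auto simp: index_mult_sum[OF K' K] simp del: index_mult_mat(1))
  have Q': "mat_adjoint ?Q = ?Q"
  proof (rule eq_matI)
    fix i j assume "i < dim_row ?Q" "j < dim_col ?Q"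
    then have "i < d" "j < d" using K by auto
    then show "mat_adjoint ?Q $$ (i, j) = ?Q $$ (i, j)"
      unfolding adj by (auto simp: mult.commute)
  qed (use K in auto)
  have Q: "?Q \<in> carrier_mat d d" using P by (rule minus_carrier_mat)
  have "?P * ?Q = 0\<^sub>m d d"
    by (simp only: mult_minus_distrib_mat[OF P one_carrier_mat P] right_mult_one_mat[OF P] PP
      minus_r_inv_mat[OF P])
  then have "?Q * ?Q = ?Q - 0\<^sub>m d d"
    by (simp only: minus_mult_distrib_mat[OF one_carrier_mat P Q] left_mult_one_mat[OF Q])
  also have "\<dots> = ?Q" using K by (intro eq_matI) auto
  finally have "?Q * ?Q = ?Q" .
  then have "mat_sum d (\<lambda>m. mat_adjoint ([K, ?Q] ! m) * ([K, ?Q] ! m)) {..<length [K, ?Q]} = 1\<^sub>m d"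
    using P by (intro eq_matI) (auto simp: mat_sum_def Q' lessThan_Suc)
  then show ?thesis using K by (simp add: instrument_def)
qed

text \<open>The first laboratory measures with \<open>K\<close>, and the second measures with
  \<open>L\<close> only in the branch where that succeeded. The head of the list is the branch in
  which both succeed.\<close>

lemma locc_filter:
  fixes K L :: "complex mat"
  assumes K: "K \<in> carrier_mat k dA" "K * mat_adjoint K = 1\<^sub>m k"
    and L: "L \<in> carrier_mat l dB" "L * mat_adjoint L = 1\<^sub>m l"
  shows "\<exists>bs. locc dA dB ((K, L) # bs)"
proof -
  let ?K = "1\<^sub>m dA - mat_adjoint K * K" and ?L = "1\<^sub>m dB - mat_adjoint L * L"
  have "locc dA dB ([] @ map (\<lambda>K. (K * 1\<^sub>m dA, 1\<^sub>m dB)) [K, ?K] @ [])"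
    by (rule first_lab) (use locc.start instrument_coisometry[OF K] in auto)
  then have "locc dA dB ([] @ (K, 1\<^sub>m dB) # [(?K * 1\<^sub>m dA, 1\<^sub>m dB)])"
    using K by simp
  then have "locc dA dB ([] @ map (\<lambda>L. (K, L * 1\<^sub>m dB)) [L, ?L] @ [(?K * 1\<^sub>m dA, 1\<^sub>m dB)])"
    by (rule second_lab) (use instrument_coisometry[OF L] in auto)
  then show ?thesis using L by auto
qed

text \<open>Postselection on the success branch alone, that is \<open>S = {0}\<close>.\<close>

lemma locc_obtainable_filter:
  fixes K L \<rho> :: "complex mat"
  assumes K: "K \<in> carrier_mat 2 dA" "K * mat_adjoint K = 1\<^sub>m 2"
    and L: "L \<in> carrier_mat 2 dB" "L * mat_adjoint L = 1\<^sub>m 2"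
    and \<tau>: "\<tau> = (K \<otimes>\<^sub>k L) * \<rho> * mat_adjoint (K \<otimes>\<^sub>k L)" "mat_trace \<tau> \<noteq> 0"
  shows "locc_obtainable dA dB \<rho> ((1 / mat_trace \<tau>) \<cdot>\<^sub>m \<tau>)"
proof -
  obtain bs where bs: "locc dA dB ((K, L) # bs)"
    using locc_filter[OF K L] by blast
  have "\<tau> = mat_sum 4 (\<lambda>m. (fst (((K, L) # bs) ! m) \<otimes>\<^sub>k snd (((K, L) # bs) ! m)) * \<rho> *
      mat_adjoint (fst (((K, L) # bs) ! m) \<otimes>\<^sub>k snd (((K, L) # bs) ! m))) {0}"
    using K(1) L(1) unfolding \<tau>(1) by (intro eq_matI) (auto simp: mat_sum_def)
  then show ?thesis
    unfolding locc_obtainable_def using bs K(1) L(1) \<tau>(2)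
    by (intro exI[of _ "(K, L) # bs"] exI[of _ "{0}"] exI[of _ \<tau>]) auto
qed

text \<open>Row \<open>s * l + t\<close> of \<open>K \<otimes>\<^sub>k L\<close> is the product of
  row \<open>s\<close> of \<open>K\<close> and row \<open>t\<close> of \<open>L\<close>; this
  reduces the output state to values of \<open>product_form\<close>.\<close>

lemma index_filtered:
  fixes K L M :: "complex mat"
  assumes K: "K \<in> carrier_mat k m" and L: "L \<in> carrier_mat l n" and M: "M \<in> carrier_mat (m * n) (m * n)"
    and "s < k" "t < l" "s' < k" "t' < l"
  shows "((K \<otimes>\<^sub>k L) * M * mat_adjoint (K \<otimes>\<^sub>k L)) $$ (s * l + t, s' * l + t') =
    product_form m n M (\<lambda>i. K $$ (s, i)) (\<lambda>j. L $$ (t, j)) (\<lambda>i. K $$ (s', i)) (\<lambda>j. L $$ (t', j))"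
proof -
  let ?N = "K \<otimes>\<^sub>k L" and ?x = "s * l + t" and ?y = "s' * l + t'"
  have N: "?N \<in> carrier_mat (k * l) (m * n)" using K L by simp
  have xy: "?x < k * l" "?y < k * l" using assms mult_add_less by auto
  have "(?N * M * mat_adjoint ?N) $$ (?x, ?y) =
    (\<Sum>c<m * n. (\<Sum>r<m * n. ?N $$ (?x, r) * M $$ (r, c)) * cnj (?N $$ (?y, c)))"
    using N M xy
    by (subst index_mult_sum[of _ "k * l" "m * n" _ "k * l"])
      (auto simp: index_mult_sum[OF N M] carrier_matD[OF K] carrier_matD[OF L]
        simp del: index_mult_mat(1) intro!: sum.cong)
  also have "\<dots> = (\<Sum>r<m * n. \<Sum>c<m * n. ?N $$ (?x, r) * M $$ (r, c) * cnj (?N $$ (?y, c)))"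
    by (subst sum.swap) (simp add: sum_distrib_right)
  also have "\<dots> = (\<Sum>i<m. \<Sum>j<n. \<Sum>i'<m. \<Sum>j'<n. ?N $$ (?x, i * n + j) *
      M $$ (i * n + j, i' * n + j') * cnj (?N $$ (?y, i' * n + j')))"
    by (simp only: sum_lessThan_mult)
  also have "\<dots> = product_form m n M (\<lambda>i. K $$ (s, i)) (\<lambda>j. L $$ (t, j))
      (\<lambda>i. K $$ (s', i)) (\<lambda>j. L $$ (t', j))"
    unfolding product_form_def
    by (intro sum.cong refl) (use assms in \<open>simp add: index_kron[OF K L]\<close>)
  finally show ?thesis .
qed

section \<open>Fidelity of the filtered state\<close>

lemma fidelity_max_entangled:
  assumes "\<sigma> \<in> carrier_mat 4 4"
  shows "fidelity_pure \<sigma> max_entangled =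
    Re (\<sigma> $$ (0, 0) + \<sigma> $$ (0, 3) + \<sigma> $$ (3, 0) + \<sigma> $$ (3, 3)) / 2"
proof -
  define h :: complex where "h = complex_of_real (1 / sqrt 2)"
  have h: "h * h = 1 / 2" "cnj h = h"
    unfolding h_def of_real_mult[symmetric] by simp_all
  have "(\<sigma> *\<^sub>v max_entangled) \<bullet>c max_entangled =
      (h * h) * (\<sigma> $$ (0, 0) + \<sigma> $$ (0, 3) + \<sigma> $$ (3, 0) + \<sigma> $$ (3, 3))"
    using assms h(2) unfolding max_entangled_def h_def[symmetric]
    by (simp add: scalar_prod_def mult_mat_vec_def unit_vec_def row_def eval_nat_numeral algebra_simps)
  then show ?thesis by (simp only: fidelity_pure_def h) simp
qed

text \<open>The filters have the \<open>l\<close>-th tensor powers of \<open>u s\<close> and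
  \<open>w t\<close> as rows. The output has \<open>A ^ l\<close> in the four entries between
  \<open>|00>\<close> and \<open>|11>\<close>, and \<open>B ^ l\<close> in the diagonal entries of
  \<open>|01>\<close> and \<open>|10>\<close>. Trace and fidelity read only these six, so the
  fidelity is \<open>1 / (1 + (B / A) ^ l)\<close>, which tends to 1.\<close>

lemma distillable_of_filters:
  fixes A B :: real and u w :: "nat \<Rightarrow> nat \<Rightarrow> complex"
  assumes M: "M \<in> carrier_mat (m * n) (m * n)"
    and u: "\<And>s s'. s < 2 \<Longrightarrow> s' < 2 \<Longrightarrow> (\<Sum>i<m. u s i * cnj (u s' i)) = (if s = s' then 1 else 0)"
    and w: "\<And>t t'. t < 2 \<Longrightarrow> t' < 2 \<Longrightarrow> (\<Sum>j<n. w t j * cnj (w t' j)) = (if t = t' then 1 else 0)"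
    and A: "\<And>s s'. s < 2 \<Longrightarrow> s' < 2 \<Longrightarrow> product_form m n M (u s) (w s) (u s') (w s') = A"
    and B: "\<And>s. s < 2 \<Longrightarrow> product_form m n M (u s) (w (1 - s)) (u s) (w (1 - s)) = B"
    and AB: "0 \<le> B" "B < A"
  shows "distillable m n M"
  unfolding distillable_def
proof (intro allI impI)
  fix \<epsilon> :: real assume \<epsilon>: "\<epsilon> > 0"
  define x where "x = B / A"
  have x: "0 \<le> x" "x < 1" using AB by (auto simp: x_def)
  obtain k where k: "x ^ k < \<epsilon>" using real_arch_pow_inv[OF \<epsilon> x(2)] by blast
  \<comment> \<open>At least one copy is taken: the zeroth powers of orthogonal vectors would have
    inner product \<open>0 ^ 0 = 1\<close>.\<close>
  define l where "l = Suc k"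
  have xl: "x ^ l < \<epsilon>" "0 \<le> x ^ l"
    using k x mult_left_le_one_le[of "x ^ k" x] by (auto simp: l_def)
  define K where "K = mat 2 (m ^ l) (\<lambda>(s, i). tensor_power m (u s) l i)"
  define L where "L = mat 2 (n ^ l) (\<lambda>(t, j). tensor_power n (w t) l j)"
  have KL: "K \<in> carrier_mat 2 (m ^ l)" "L \<in> carrier_mat 2 (n ^ l)" by (auto simp: K_def L_def)
  have KK: "K * mat_adjoint K = 1\<^sub>m 2"
  proof (rule eq_matI)
    fix s s' assume s: "s < dim_row (1\<^sub>m 2 :: complex mat)" "s' < dim_col (1\<^sub>m 2 :: complex mat)"
    then have "(K * mat_adjoint K) $$ (s, s') =
        (\<Sum>i<m ^ l. tensor_power m (u s) l i * cnj (tensor_power m (u s') l i))"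
      using KL by (subst index_mult_sum[of _ 2 "m ^ l" _ 2]) (auto simp: K_def intro!: sum.cong)
    then show "(K * mat_adjoint K) $$ (s, s') = 1\<^sub>m 2 $$ (s, s')"
      unfolding tensor_power_inner using s by (simp add: u l_def)
  qed (use KL in auto)
  have LL: "L * mat_adjoint L = 1\<^sub>m 2"
  proof (rule eq_matI)
    fix s s' assume s: "s < dim_row (1\<^sub>m 2 :: complex mat)" "s' < dim_col (1\<^sub>m 2 :: complex mat)"
    then have "(L * mat_adjoint L) $$ (s, s') =
        (\<Sum>i<n ^ l. tensor_power n (w s) l i * cnj (tensor_power n (w s') l i))"
      using KL by (subst index_mult_sum[of _ 2 "n ^ l" _ 2]) (auto simp: L_def intro!: sum.cong)
    then show "(L * mat_adjoint L) $$ (s, s') = 1\<^sub>m 2 $$ (s, s')"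
      unfolding tensor_power_inner using s by (simp add: w l_def)
  qed (use KL in auto)
  define \<tau> where "\<tau> = (K \<otimes>\<^sub>k L) * copies m n M l * mat_adjoint (K \<otimes>\<^sub>k L)"
  have \<tau>: "\<tau> \<in> carrier_mat 4 4" using KL by (auto simp: \<tau>_def)
  have entry: "\<tau> $$ (s * 2 + t, s' * 2 + t') = product_form m n M (u s) (w t) (u s') (w t') ^ l"
    if "s < 2" "t < 2" "s' < 2" "t' < 2" for s t s' t'
  proof -
    have "\<tau> $$ (s * 2 + t, s' * 2 + t') = product_form (m ^ l) (n ^ l) (copies m n M l)
      (tensor_power m (u s) l) (tensor_power n (w t) l)
      (tensor_power m (u s') l) (tensor_power n (w t') l)"
      unfolding \<tau>_def index_filtered[OF KL copies_carrier that] product_form_def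
      by (intro sum.cong refl) (use that in \<open>simp add: K_def L_def\<close>)
    then show ?thesis by (simp only: product_form_copies[OF M])
  qed
  \<comment> \<open>The indices 0, 1, 2, 3 stand for \<open>|00>\<close>, \<open>|01>\<close>,
    \<open>|10>\<close>, \<open>|11>\<close>; at 1 and 2 the laboratories disagree.\<close>
  have diag: "\<tau> $$ (0, 0) = A ^ l" "\<tau> $$ (3, 3) = A ^ l" "\<tau> $$ (0, 3) = A ^ l" "\<tau> $$ (3, 0) = A ^ l"
      "\<tau> $$ (1, 1) = B ^ l" "\<tau> $$ (2, 2) = B ^ l"
    using entry[of 0 0 0 0] entry[of 1 1 1 1] entry[of 0 0 1 1] entry[of 1 1 0 0]
      entry[of 0 1 0 1] entry[of 1 0 1 0] B[of 0] B[of 1]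
    by (simp_all add: A eval_nat_numeral)
  have pos: "A ^ l > 0" "B ^ l \<ge> 0" using AB by auto
  have trace: "mat_trace \<tau> = of_real (2 * (A ^ l + B ^ l))"
    using \<tau> diag by (simp add: mat_trace_def eval_nat_numeral)
  have "mat_trace \<tau> \<noteq> 0" unfolding trace of_real_eq_0_iff using pos by simp
  then have "locc_obtainable (m ^ l) (n ^ l) (copies m n M l) ((1 / mat_trace \<tau>) \<cdot>\<^sub>m \<tau>)"
    by (rule locc_obtainable_filter[OF KL(1) KK KL(2) LL \<tau>_def])
  moreover have "fidelity_pure ((1 / mat_trace \<tau>) \<cdot>\<^sub>m \<tau>) max_entangled = A ^ l / (A ^ l + B ^ l)"
  proof -
    let ?\<sigma> = "(1 / mat_trace \<tau>) \<cdot>\<^sub>m \<tau>"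
    have \<sigma>: "?\<sigma> \<in> carrier_mat 4 4" using \<tau> by simp
    define S where "S = A ^ l + B ^ l"
    have "S \<noteq> 0" using pos by (simp add: S_def)
    have "?\<sigma> $$ (0, 0) + ?\<sigma> $$ (0, 3) + ?\<sigma> $$ (3, 0) + ?\<sigma> $$ (3, 3) =
        4 * (1 / mat_trace \<tau> * of_real (A ^ l))"
      using \<tau> by (simp add: diag)
    also have "\<dots> = of_real (2 * (A ^ l / S))"
      unfolding trace S_def[symmetric] using \<open>S \<noteq> 0\<close> by (simp add: field_simps)
    finally show ?thesis
      unfolding fidelity_max_entangled[OF \<sigma>] S_def[symmetric] by (simp only: Re_complex_of_real) simp
  qed
  moreover have "A ^ l / (A ^ l + B ^ l) = 1 / (1 + x ^ l)"
    using pos AB by (simp add: x_def power_divide field_simps)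
  moreover have "1 / (1 + x ^ l) > 1 - \<epsilon>"
  proof -
    have "(1 - x ^ l) * (1 + x ^ l) \<le> 1" by (simp add: algebra_simps)
    then have "1 - x ^ l \<le> 1 / (1 + x ^ l)" using xl by (simp add: pos_le_divide_eq)
    then show ?thesis using xl by linarith
  qed
  ultimately show "\<exists>n' \<sigma>. locc_obtainable (m ^ n') (n ^ n') (copies m n M n') \<sigma> \<and>
      1 - \<epsilon> < fidelity_pure \<sigma> max_entangled" by metis
qed

section \<open>Distillation from a single coherence\<close>

definition two_point :: "nat \<Rightarrow> complex \<Rightarrow> nat \<Rightarrow> complex \<Rightarrow> nat \<Rightarrow> complex" where
  "two_point i a j b k = (if k = i then a else if k = j then b else 0)"

lemma cnj_two_point: "cnj (two_point i a j b k) = two_point i (cnj a) j (cnj b) k"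
  by (simp add: two_point_def)

lemma sum_two_point:
  assumes "i < m" "j < m" "i \<noteq> j"
  shows "(\<Sum>k<m. two_point i a j b k * f k) = a * f i + b * f j"
proof -
  have "(\<Sum>k<m. two_point i a j b k * f k) = (\<Sum>k\<in>{i, j}. two_point i a j b k * f k)"
    using assms by (intro sum.mono_neutral_right) (auto simp: two_point_def)
  then show ?thesis using assms by (simp add: two_point_def)
qed

text \<open>The phase \<open>\<beta>\<close> cancels against its conjugate, leaving
  \<open>(1 + (-1) ^ (s + s')) / 2\<close>.\<close>

lemma two_point_orthonormal:
  assumes ij: "i < m" "j < m" "i \<noteq> j" and \<beta>: "\<beta> * cnj \<beta> = 1" and s: "s < 2" "s' < 2"
  defines "h \<equiv> complex_of_real (1 / sqrt 2)"
  shows "(\<Sum>k<m. two_point i h j ((- 1) ^ s * \<beta> * h) k * cnj (two_point i h j ((- 1) ^ s' * \<beta> * h) k)) =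
    (if s = s' then 1 else 0)"
proof -
  have h: "h * h = 1 / 2" "cnj h = h"
    unfolding h_def of_real_mult[symmetric] by simp_all
  have "(\<Sum>k<m. two_point i h j ((- 1) ^ s * \<beta> * h) k * cnj (two_point i h j ((- 1) ^ s' * \<beta> * h) k)) =
      h * h + (- 1) ^ s * (- 1) ^ s' * (\<beta> * cnj \<beta>) * (h * h)"
    unfolding sum_two_point[OF ij] using ij h(2) by (simp add: two_point_def mult_ac)
  then show ?thesis unfolding h \<beta> using s by (auto simp: less_2_cases_iff)
qed

text \<open>Each laboratory uses the normalised sum and difference of its two basis vectors. By
  \<open>z\<close>, only \<open>p\<close>, \<open>r\<close>, \<open>q\<close> and
  \<open>cnj q\<close> remain of the 16 entries on their products. Equal signs in the two
  laboratories make the coherences add to the populations, opposite signs make them subtract, which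
  gives the constants \<open>A\<close> and \<open>B\<close> of
  \<open>distillable_of_filters\<close>.\<close>

lemma distillable_of_coherence:
  fixes M :: "complex mat" and p r :: real and q :: complex
  assumes M: "M \<in> carrier_mat (m * n) (m * n)"
    and i: "i0 < m" "i1 < m" "i0 \<noteq> i1" and j: "j0 < n" "j1 < n" "j0 \<noteq> j1"
    and e: "M $$ (i0 * n + j0, i0 * n + j0) = p" "M $$ (i1 * n + j1, i1 * n + j1) = r"
      "M $$ (i0 * n + j0, i1 * n + j1) = q" "M $$ (i1 * n + j1, i0 * n + j0) = cnj q"
    and z: "\<And>x y. x \<in> {i0 * n + j1, i1 * n + j0} \<Longrightarrow>
      y \<in> {i0 * n + j0, i0 * n + j1, i1 * n + j0, i1 * n + j1} \<Longrightarrow> M $$ (x, y) = 0 \<and> M $$ (y, x) = 0"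
    and q: "q \<noteq> 0" "2 * cmod q \<le> p + r"
  shows "distillable m n M"
proof -
  define h where "h = complex_of_real (1 / sqrt 2)"
  have h: "h * h = 1 / 2" "cnj h = h"
    unfolding h_def of_real_mult[symmetric] by simp_all
  \<comment> \<open>The first laboratory absorbs the phase of \<open>q\<close>, so both coherences
    become \<open>cmod q\<close>.\<close>
  define \<beta> where "\<beta> = sgn q"
  have qq: "q * cnj q = of_real (cmod q) * of_real (cmod q)"
    by (simp add: complex_norm_square[symmetric] power2_eq_square[symmetric])
  have \<beta>: "\<beta> * cnj \<beta> = 1" "q * cnj \<beta> = cmod q" "cnj q * \<beta> = cmod q"
    using q(1) qq by (simp_all add: \<beta>_def sgn_eq field_simps)
  define u where "u = (\<lambda>s::nat. two_point i0 h i1 ((- 1) ^ s * \<beta> * h))"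
  define w where "w = (\<lambda>t::nat. two_point j0 h j1 ((- 1) ^ t * 1 * h))"
  have form: "product_form m n M (u s) (w t) (u s') (w t') =
     (p + (- 1) ^ (s' + t') * cmod q + (- 1) ^ (s + t) * cmod q + (- 1) ^ (s + t + s' + t') * r) / 4"
    for s t s' t'
  proof -
    \<comment> \<open>Each weight is pulled directly behind its own sum, the shape that
      \<open>sum_two_point\<close> collapses.\<close>
    have "product_form m n M (u s) (w t) (u s') (w t') = (\<Sum>i<m. u s i * (\<Sum>j<n. w t j *
        (\<Sum>i'<m. cnj (u s' i') * (\<Sum>j'<n. cnj (w t' j') * M $$ (i * n + j, i' * n + j')))))"
      unfolding product_form_def sum_distrib_left by (intro sum.cong refl) (simp add: mult_ac)
    also have "\<dots> = (h * h) * (h * h) * (p + (- 1) ^ (s' + t') * (q * cnj \<beta>) +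
        (- 1) ^ (s + t) * (cnj q * \<beta>) + (- 1) ^ (s + t + s' + t') * (\<beta> * cnj \<beta>) * r)"
      unfolding u_def w_def cnj_two_point sum_two_point[OF i] sum_two_point[OF j] h(2)
      by (simp add: e z h(2)) (simp add: algebra_simps power_add)
    finally show ?thesis unfolding h \<beta> by simp
  qed
  show ?thesis
  proof (rule distillable_of_filters[OF M, where u = u and w = w])
    show "(\<Sum>i<m. u s i * cnj (u s' i)) = (if s = s' then 1 else 0)" if "s < 2" "s' < 2" for s s'
      unfolding u_def h_def by (rule two_point_orthonormal[OF i \<beta>(1) that])
    show "(\<Sum>j<n. w t j * cnj (w t' j)) = (if t = t' then 1 else 0)" if "t < 2" "t' < 2" for t t'
      unfolding w_def h_def by (rule two_point_orthonormal[OF j _ that]) simp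
    show "product_form m n M (u s) (w s) (u s') (w s') = of_real ((p + r + 2 * cmod q) / 4)"
      if "s < 2" "s' < 2" for s s'
      unfolding form using that by (auto simp: less_2_cases_iff)
    show "product_form m n M (u s) (w (1 - s)) (u s) (w (1 - s)) = of_real ((p + r - 2 * cmod q) / 4)"
      if "s < 2" for s
      unfolding form using that by (auto simp: less_2_cases_iff)
    show "0 \<le> (p + r - 2 * cmod q) / 4" "(p + r - 2 * cmod q) / 4 < (p + r + 2 * cmod q) / 4"
      using q by auto
  qed
qed

section \<open>Consequences of positivity and unitarity\<close>

text \<open>The bound comes from testing positivity on \<open>e_i + \<beta> e_j\<close>. With a
  phase \<open>\<beta>\<close> opposite to that of the entry, the form equals the two diagonal
  entries minus twice the modulus.\<close>

lemma psd_entries: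
  assumes psd: "psd d M" and ij: "i < d" "j < d"
  shows "M $$ (j, i) = cnj (M $$ (i, j))"
    and "i \<noteq> j \<Longrightarrow> 2 * cmod (M $$ (i, j)) \<le> Re (M $$ (i, i)) + Re (M $$ (j, j))"
proof -
  have M: "M \<in> carrier_mat d d" and adj: "mat_adjoint M = M" using psd by (auto simp: psd_def)
  have herm: "M $$ (r, c) = cnj (M $$ (c, r))" if "r < d" "c < d" for r c
    using index_mat_adjoint[of r M c] M that unfolding adj by auto
  then show "M $$ (j, i) = cnj (M $$ (i, j))" using ij by blast
  assume ne: "i \<noteq> j"
  let ?q = "M $$ (i, j)"
  \<comment> \<open>The case distinction keeps \<open>\<beta>\<close> of modulus one, because
    \<open>sgn 0 = 0\<close>.\<close>
  define \<beta> where "\<beta> = (if ?q = 0 then 1 else - sgn (cnj ?q))"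
  have qq: "?q * cnj ?q = of_real (cmod ?q) * of_real (cmod ?q)"
    by (simp add: complex_norm_square[symmetric] power2_eq_square[symmetric])
  then have \<beta>: "?q * \<beta> = - cmod ?q" "\<beta> * cnj \<beta> = 1"
    by (auto simp: \<beta>_def sgn_eq field_simps)
  let ?u = "two_point i 1 j \<beta>"
  define v where "v = vec d ?u"
  have "(M *\<^sub>v v) \<bullet>c v = (\<Sum>r<d. (\<Sum>c<d. M $$ (r, c) * ?u c) * cnj (?u r))"
    using M by (auto simp: v_def scalar_prod_def atLeast0LessThan intro!: sum.cong)
  also have "\<dots> = (\<Sum>r<d. two_point i 1 j (cnj \<beta>) r * (\<Sum>c<d. ?u c * M $$ (r, c)))"
    by (simp add: cnj_two_point mult.commute)
  also have "\<dots> = M $$ (i, i) + ?q * \<beta> + cnj (?q * \<beta>) + M $$ (j, j) * (\<beta> * cnj \<beta>)"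
    using herm[OF ij(2,1)] by (simp add: sum_two_point[OF ij ne]) (simp add: algebra_simps)
  finally have eq: "(M *\<^sub>v v) \<bullet>c v = \<dots>" .
  have "0 \<le> (M *\<^sub>v v) \<bullet>c v" using psd by (auto simp: psd_def v_def)
  then have "0 \<le> Re ((M *\<^sub>v v) \<bullet>c v)" by (simp add: less_eq_complex_def)
  then show "2 * cmod ?q \<le> Re (M $$ (i, i)) + Re (M $$ (j, j))"
    unfolding eq \<beta> by simp
qed

lemma mult_add_eqD:
  fixes i j i' j' n :: nat
  assumes "i * n + j = i' * n + j'" "j < n" "j' < n"
  shows "i = i'"
proof -
  have "(i * n + j) div n = i" "(i' * n + j') div n = i'" using assms(2,3) by simp_all
  then show ?thesis using assms(1) by simp
qed

lemma exists_digits: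
  assumes "(k::nat) < m * n"
  obtains i j where "i < m" "j < n" "k = i * n + j"
proof
  have "n > 0" using assms by (intro Nat.gr0I) auto
  then show "k mod n < n" by simp
  show "k div n < m" using assms by (simp add: less_mult_imp_div_less)
  show "k = k div n * n + k mod n" by simp
qed

text \<open>If all entries vanished, multiplying by \<open>mat_adjoint U\<close> on the left and
  \<open>V\<close> on the right would give \<open>R = 0\<close>, against trace one.\<close>

lemma unitary_conjugation_nonzero:
  assumes R: "density_operator d R" and U: "unitary_op d U" "unitary_op d V"
  obtains i j where "i < d" "j < d" "(U * R * mat_adjoint V) $$ (i, j) \<noteq> 0"
proof (rule ccontr)
  assume "\<not> thesis"
  with that have z: "(U * R * mat_adjoint V) $$ (i, j) = 0" if "i < d" "j < d" for i j
    using that by blast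
  have c: "R \<in> carrier_mat d d" "U \<in> carrier_mat d d" "V \<in> carrier_mat d d"
    using R U by (auto simp: density_operator_def psd_def unitary_op_def)
  note c' = c(1) mat_adjoint_carrier[OF c(2)] mat_adjoint_carrier[OF c(3)]
  have "U * R * mat_adjoint V = 0\<^sub>m d d"
    using c z by (intro eq_matI) auto
  then have "mat_adjoint U * (U * R * mat_adjoint V) * V = 0\<^sub>m d d"
    by (simp only: right_mult_zero_mat[OF c'(2)] left_mult_zero_mat[OF c(3)])
  moreover have "mat_adjoint U * (U * R * mat_adjoint V) * V =
      (mat_adjoint U * U) * (R * mat_adjoint V) * V"
    by (simp only: assoc_mult_mat[OF c(2) c(1) c'(3)]
      assoc_mult_mat[OF c'(2) c(2) mult_carrier_mat[OF c(1) c'(3)]])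
  moreover have "\<dots> = R * (mat_adjoint V * V)"
    using U(1) c c' by (simp add: unitary_op_def assoc_mult_mat[OF c(1) c'(3) c(3)])
  ultimately have "R = 0\<^sub>m d d"
    using U(2) c by (simp add: unitary_op_def)
  then show False using R by (simp add: density_operator_def mat_trace_def)
qed

section \<open>Entries of a secret-sharing state\<close>

text \<open>Bits and shield digits are functions of the party, so that one argument with variable
  parties can serve all splits. The bracketing of the bits follows the right-associated product of
  the \<open>ketbra\<close> factors.\<close>

definition system_index :: "nat \<Rightarrow> nat \<Rightarrow> nat \<Rightarrow> (nat \<Rightarrow> nat) \<Rightarrow> (nat \<Rightarrow> nat) \<Rightarrow> nat" where
  "system_index a b c \<beta> \<xi> =
     (\<beta> 0 * (2 * 2) + (\<beta> 1 * 2 + \<beta> 2)) * (a * b * c) + ((\<xi> 0 * b + \<xi> 1) * c + \<xi> 2)"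

lemma system_index_less:
  assumes "\<And>k. \<beta> k < 2" "(\<xi> 0 * b + \<xi> 1) * c + \<xi> 2 < a * b * c"
  shows "system_index a b c \<beta> \<xi> < 2 * 2 * 2 * a * b * c"
  using mult_add_less[OF mult_add_less[OF assms(1)[of 0] mult_add_less[OF assms(1)[of 1] assms(1)[of 2]]] assms(2)]
  by (simp add: system_index_def mult_ac)

text \<open>The \<open>ketbra\<close> factors annihilate every summand except the one labelled by
  the bits of the row and the column, and that summand occurs exactly when both parities are
  even.\<close>

lemma index_secret_sharing:
  fixes \<beta> \<beta>' \<xi> \<xi>' :: "nat \<Rightarrow> nat"
  assumes bits: "\<And>k. \<beta> k < 2" "\<And>k. \<beta>' k < 2"
    and digits: "(\<xi> 0 * b + \<xi> 1) * c + \<xi> 2 < a * b * c" "(\<xi>' 0 * b + \<xi>' 1) * c + \<xi>' 2 < a * b * c"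
    and F: "\<And>t t'. t \<in> even_triples \<Longrightarrow> t' \<in> even_triples \<Longrightarrow> F t t' \<in> carrier_mat (a * b * c) (a * b * c)"
    and \<rho>: "\<rho> = (1/4) \<cdot>\<^sub>m mat_sum (2 * 2 * 2 * a * b * c)
          (\<lambda>((i, j, k), (i', j', k')).
             (ketbra 2 i i' \<otimes>\<^sub>k ketbra 2 j j' \<otimes>\<^sub>k ketbra 2 k k') \<otimes>\<^sub>k F (i, j, k) (i', j', k'))
          (even_triples \<times> even_triples)"
  shows "\<rho> $$ (system_index a b c \<beta> \<xi>, system_index a b c \<beta>' \<xi>') =
    (if even (\<beta> 0 + \<beta> 1 + \<beta> 2) \<and> even (\<beta>' 0 + \<beta>' 1 + \<beta>' 2)
     then 1/4 * F (\<beta> 0, \<beta> 1, \<beta> 2) (\<beta>' 0, \<beta>' 1, \<beta>' 2) $$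
       ((\<xi> 0 * b + \<xi> 1) * c + \<xi> 2, (\<xi>' 0 * b + \<xi>' 1) * c + \<xi>' 2) else 0)"
proof -
  define X where "X = (\<xi> 0 * b + \<xi> 1) * c + \<xi> 2"
  define Y where "Y = (\<xi>' 0 * b + \<xi>' 1) * c + \<xi>' 2"
  note XY = digits[folded X_def Y_def]
  let ?s = "(\<beta> 0, \<beta> 1, \<beta> 2)" and ?s' = "(\<beta>' 0, \<beta>' 1, \<beta>' 2)"
  let ?x = "system_index a b c \<beta> \<xi>" and ?y = "system_index a b c \<beta>' \<xi>'"
  let ?f = "\<lambda>((i, j, k), (i', j', k')).
     (ketbra 2 i i' \<otimes>\<^sub>k ketbra 2 j j' \<otimes>\<^sub>k ketbra 2 k k') \<otimes>\<^sub>k F (i, j, k) (i', j', k')"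
  have k2: "ketbra 2 i i' \<in> carrier_mat 2 2" for i i' by (simp add: ketbra_def)
  have xy: "?x < 2 * 2 * 2 * a * b * c" "?y < 2 * 2 * 2 * a * b * c"
    using system_index_less bits digits by blast+
  have entry: "?f tt $$ (?x, ?y) = (if tt = (?s, ?s') then F ?s ?s' $$ (X, Y) else 0)"
    if "tt \<in> even_triples \<times> even_triples" for tt
  proof -
    obtain i j k i' j' k' where tt: "tt = ((i, j, k), (i', j', k'))" by (metis prod_cases3 surj_pair)
    have FF: "F (i, j, k) (i', j', k') \<in> carrier_mat (a * b * c) (a * b * c)"
      using F that tt by auto
    have "?f tt $$ (?x, ?y) = (ketbra 2 i i' $$ (\<beta> 0, \<beta>' 0) * (ketbra 2 j j' $$ (\<beta> 1, \<beta>' 1) *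
        ketbra 2 k k' $$ (\<beta> 2, \<beta>' 2))) * F (i, j, k) (i', j', k') $$ (X, Y)"
      unfolding tt system_index_def X_def[symmetric] Y_def[symmetric] prod.case
      by (simp only:
        index_kron[OF kron_carrier[OF k2 kron_carrier[OF k2 k2]] FF
          mult_add_less[OF bits(1) mult_add_less[OF bits(1,1)]] XY(1)
          mult_add_less[OF bits(2) mult_add_less[OF bits(2,2)]] XY(2)]
        index_kron[OF k2 kron_carrier[OF k2 k2] bits(1) mult_add_less[OF bits(1,1)]
          bits(2) mult_add_less[OF bits(2,2)]]
        index_kron[OF k2 k2 bits(1,1,2,2)])
    also have "\<dots> = (if tt = (?s, ?s') then F ?s ?s' $$ (X, Y) else 0)"
      using bits by (simp add: tt ketbra_def)
    finally show ?thesis .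
  qed
  have "even_triples \<subseteq> {0, 1} \<times> {0, 1} \<times> {0, 1}"
    unfolding even_triples_def by blast
  then have "finite even_triples" by (rule finite_subset) simp
  then have fin: "finite (even_triples \<times> even_triples)" by simp
  have "\<rho> $$ (?x, ?y) = 1/4 * (\<Sum>tt\<in>even_triples \<times> even_triples. ?f tt $$ (?x, ?y))"
    unfolding \<rho> using xy by (simp add: mat_sum_def)
  also have "(\<Sum>tt\<in>even_triples \<times> even_triples. ?f tt $$ (?x, ?y)) =
     (\<Sum>tt\<in>even_triples \<times> even_triples. if tt = (?s, ?s') then F ?s ?s' $$ (X, Y) else 0)"
    by (rule sum.cong[OF refl entry])
  also have "\<dots> = (if (?s, ?s') \<in> even_triples \<times> even_triples then F ?s ?s' $$ (X, Y) else 0)"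
    by (simp only: sum.delta[OF fin])
  also have "(?s, ?s') \<in> even_triples \<times> even_triples \<longleftrightarrow>
      even (\<beta> 0 + \<beta> 1 + \<beta> 2) \<and> even (\<beta>' 0 + \<beta>' 1 + \<beta>' 2)"
    using bits by (auto simp: even_triples_def less_2_cases_iff)
  finally have eq: "\<rho> $$ (?x, ?y) = 1/4 *
      (if even (\<beta> 0 + \<beta> 1 + \<beta> 2) \<and> even (\<beta>' 0 + \<beta>' 1 + \<beta>' 2) then F ?s ?s' $$ (X, Y) else 0)" .
  show ?thesis unfolding X_def[symmetric] Y_def[symmetric] eq by simp
qed

text \<open>Party \<open>k\<close> owns the positions \<open>k\<close> and \<open>k + 3\<close>. The
  cyclic triples put party \<open>u\<close> alone in the first laboratory, and in mixed radix its
  index is the leading part of the reordered index.\<close>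

lemma index_split:
  fixes a b c :: nat and \<beta> \<beta>' \<xi> \<xi>' :: "nat \<Rightarrow> nat"
  defines "d \<equiv> \<lambda>k. [a, b, c] ! k"
  assumes uvw: "(u, v, w) \<in> {(0, 1, 2), (1, 2, 0), (2, 0, 1)}"
    and "\<And>k. \<beta> k < 2" "\<And>k. \<beta>' k < 2" "\<And>k. k < 3 \<Longrightarrow> \<xi> k < d k" "\<And>k. k < 3 \<Longrightarrow> \<xi>' k < d k"
  shows "permute_systems [2, 2, 2, a, b, c] [u, u + 3, v, v + 3, w, w + 3] \<rho> $$
      ((\<beta> u * d u + \<xi> u) * (2 * d v * 2 * d w) + (((\<beta> v * d v + \<xi> v) * 2 + \<beta> w) * d w + \<xi> w),
       (\<beta>' u * d u + \<xi>' u) * (2 * d v * 2 * d w) + (((\<beta>' v * d v + \<xi>' v) * 2 + \<beta>' w) * d w + \<xi>' w)) =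
    \<rho> $$ (system_index a b c \<beta> \<xi>, system_index a b c \<beta>' \<xi>')"
proof -
  let ?ds = "[2, 2, 2, a, b, c]" and ?p = "[u, u + 3, v, v + 3, w, w + 3]"
  have idx: "(\<beta> u * d u + \<xi> u) * (2 * d v * 2 * d w) + (((\<beta> v * d v + \<xi> v) * 2 + \<beta> w) * d w + \<xi> w)
       < prod_list ?ds \<and>
     permute_index ?ds ?p ((\<beta> u * d u + \<xi> u) * (2 * d v * 2 * d w) +
       (((\<beta> v * d v + \<xi> v) * 2 + \<beta> w) * d w + \<xi> w)) = system_index a b c \<beta> \<xi>"
    (is "?r < _ \<and> _") if "\<And>k. \<beta> k < 2" "\<And>k. k < 3 \<Longrightarrow> \<xi> k < d k" for \<beta> \<xi> :: "nat \<Rightarrow> nat"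
  proof -
    let ?xs = "[\<beta> u, \<xi> u, \<beta> v, \<xi> v, \<beta> w, \<xi> w]"
    have ds: "map (\<lambda>k. ?ds ! k) ?p = [2, d u, 2, d v, 2, d w]"
      using uvw by (auto simp: d_def eval_nat_numeral)
    have valid: "list_all2 (<) ?xs (map (\<lambda>k. ?ds ! k) ?p)"
      unfolding ds using that uvw by auto
    have r: "mixed_radix (map (\<lambda>k. ?ds ! k) ?p) ?xs = ?r"
      unfolding ds by (simp add: algebra_simps)
    have "permute_index ?ds ?p (mixed_radix (map (\<lambda>k. ?ds ! k) ?p) ?xs) = system_index a b c \<beta> \<xi>"
      by (subst permute_index_mixed_radix[OF valid])
        (use uvw in \<open>auto simp: system_index_def weight_def eval_nat_numeral algebra_simps\<close>)
    moreover have "mixed_radix (map (\<lambda>k. ?ds ! k) ?p) ?xs < prod_list ?ds"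
      using mixed_radix_less[OF valid] uvw unfolding ds by (auto simp: d_def mult_ac)
    ultimately show ?thesis unfolding r by blast
  qed
  show ?thesis
    using idx[of \<beta> \<xi>] idx[of \<beta>' \<xi>'] assms(3-6)
    by (simp add: index_permute_systems del: prod_list.Cons)
qed

section \<open>The three bipartite splits\<close>

lemma distillable_split:
  fixes a b c :: nat
  defines "d \<equiv> \<lambda>k. [a, b, c] ! k"
  assumes \<rho>: "secret_sharing_state a b c \<rho>"
    and uvw: "(u, v, w) \<in> {(0, 1, 2), (1, 2, 0), (2, 0, 1)}"
  shows "distillable (2 * d u) (2 * d v * 2 * d w)
    (permute_systems [2, 2, 2, a, b, c] [u, u + 3, v, v + 3, w, w + 3] \<rho>)"
proof -
  obtain R U where R: "density_operator (a * b * c) R"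
    and U: "\<forall>t \<in> even_triples. unitary_op (a * b * c) (U t)"
    and \<rho>_eq: "\<rho> = (1/4) \<cdot>\<^sub>m mat_sum (2 * 2 * 2 * a * b * c)
          (\<lambda>((i, j, k), (i', j', k')).
             (ketbra 2 i i' \<otimes>\<^sub>k ketbra 2 j j' \<otimes>\<^sub>k ketbra 2 k k') \<otimes>\<^sub>k
             (U (i, j, k) * R * mat_adjoint (U (i', j', k'))))
          (even_triples \<times> even_triples)"
    using \<rho> unfolding secret_sharing_state_def by blast
  have psd: "psd (2 * 2 * 2 * a * b * c) \<rho>"
    using \<rho> by (simp add: secret_sharing_state_def density_operator_def)
  let ?F = "\<lambda>t t'. U t * R * mat_adjoint (U t')"
  have F: "?F t t' \<in> carrier_mat (a * b * c) (a * b * c)"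
    if "t \<in> even_triples" "t' \<in> even_triples" for t t'
    using that U R by (auto simp: unitary_op_def density_operator_def psd_def
        intro!: mult_carrier_mat[of _ _ "a * b * c"])
  define \<beta>0 :: "nat \<Rightarrow> nat" where "\<beta>0 = (\<lambda>k. 0)"
  \<comment> \<open>One bit is flipped in each laboratory: the parity stays even, but exchanging the
    bit of \<open>u\<close> with \<open>\<beta>0\<close> makes it odd.\<close>
  define \<beta>1 :: "nat \<Rightarrow> nat" where "\<beta>1 = (\<lambda>k. if k = u \<or> k = w then 1 else 0)"
  let ?t0 = "(\<beta>0 0, \<beta>0 1, \<beta>0 2)" and ?t1 = "(\<beta>1 0, \<beta>1 1, \<beta>1 2)"
  have E: "?t0 \<in> even_triples" "?t1 \<in> even_triples"
    using uvw by (auto simp: \<beta>0_def \<beta>1_def even_triples_def)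
  \<comment> \<open>The coherence \<open>q\<close> is this nonzero entry up to the factor 1/4; its
    row and column fix the shield digits of the chosen basis vectors.\<close>
  obtain X Y where XY: "X < a * b * c" "Y < a * b * c" "?F ?t0 ?t1 $$ (X, Y) \<noteq> 0"
    using unitary_conjugation_nonzero[OF R] U E by metis
  have digits: "\<exists>\<xi>. X = (\<xi> 0 * b + \<xi> 1) * c + \<xi> 2 \<and> (\<forall>k<3. \<xi> k < d k)" if "X < a * b * c" for X
  proof -
    obtain h z where h: "h < a * b" "z < c" "X = h * c + z" using \<open>X < a * b * c\<close> by (rule exists_digits)
    obtain x y where x: "x < a" "y < b" "h = x * b + y" using h(1) by (rule exists_digits)
    show ?thesis
      by (rule exI[of _ "\<lambda>k. [x, y, z] ! k"])
        (use h x in \<open>auto simp: d_def eval_nat_numeral less_Suc_eq\<close>)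
  qed
  obtain \<xi>0 where \<xi>0: "X = (\<xi>0 0 * b + \<xi>0 1) * c + \<xi>0 2" "\<And>k. k < 3 \<Longrightarrow> \<xi>0 k < d k"
    using digits[OF XY(1)] by blast
  obtain \<xi>1 where \<xi>1: "Y = (\<xi>1 0 * b + \<xi>1 1) * c + \<xi>1 2" "\<And>k. k < 3 \<Longrightarrow> \<xi>1 k < d k"
    using digits[OF XY(2)] by blast
  let ?M = "permute_systems [2, 2, 2, a, b, c] [u, u + 3, v, v + 3, w, w + 3] \<rho>"
  let ?n = "2 * d v * 2 * d w"
  define first where "first = (\<lambda>\<beta> \<xi> :: nat \<Rightarrow> nat. \<beta> u * d u + \<xi> u)"
  define second where "second = (\<lambda>\<beta> \<xi> :: nat \<Rightarrow> nat. ((\<beta> v * d v + \<xi> v) * 2 + \<beta> w) * d w + \<xi> w)"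
  \<comment> \<open>Data of the first laboratory from \<open>f\<close>, of the second from
    \<open>g\<close>: every product of chosen local basis vectors is described by mixed bits and
    shields.\<close>
  define mix where "mix = (\<lambda>(f :: nat \<Rightarrow> nat) g k. if k = u then f k else g k)"
  have neq: "v \<noteq> u" "w \<noteq> u" "v \<noteq> w" "u < 3" "v < 3" "w < 3" using uvw by auto
  have mix: "first (mix \<beta> \<beta>') (mix \<xi> \<xi>') = first \<beta> \<xi>" "second (mix \<beta> \<beta>') (mix \<xi> \<xi>') = second \<beta>' \<xi>'"
    for \<beta> \<beta>' \<xi> \<xi>' using neq by (auto simp: first_def second_def mix_def)
  have same: "mix f f = f" for f by (auto simp: mix_def)
  define bits where "bits = {mix \<beta>0 \<beta>0, mix \<beta>0 \<beta>1, mix \<beta>1 \<beta>0, mix \<beta>1 \<beta>1}"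
  define shields where "shields = {mix \<xi>0 \<xi>0, mix \<xi>0 \<xi>1, mix \<xi>1 \<xi>0, mix \<xi>1 \<xi>1}"
  have bits: "\<beta> k < 2" if "\<beta> \<in> bits" for \<beta> k
    using that by (auto simp: bits_def mix_def \<beta>0_def \<beta>1_def)
  have shields: "\<xi> k < d k" if "\<xi> \<in> shields" "k < 3" for \<xi> k
    using that \<xi>0(2) \<xi>1(2) by (auto simp: shields_def mix_def)
  have less: "(\<xi> 0 * b + \<xi> 1) * c + \<xi> 2 < a * b * c" if "\<xi> \<in> shields" for \<xi>
    using mult_add_less[OF mult_add_less, of "\<xi> 0" a "\<xi> 1" b "\<xi> 2" c]
      shields[OF that, of 0] shields[OF that, of 1] shields[OF that, of 2] by (simp add: d_def)
  have entry: "?M $$ (first \<beta> \<xi> * ?n + second \<beta> \<xi>, first \<beta>' \<xi>' * ?n + second \<beta>' \<xi>') =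
      \<rho> $$ (system_index a b c \<beta> \<xi>, system_index a b c \<beta>' \<xi>')"
    if "\<beta> \<in> bits" "\<beta>' \<in> bits" "\<xi> \<in> shields" "\<xi>' \<in> shields" for \<beta> \<beta>' \<xi> \<xi>'
    unfolding first_def second_def d_def
    by (rule index_split[OF uvw]) (use that bits shields in \<open>auto simp: d_def\<close>)
  have \<rho>_entry: "\<rho> $$ (system_index a b c \<beta> \<xi>, system_index a b c \<beta>' \<xi>') =
    (if even (\<beta> 0 + \<beta> 1 + \<beta> 2) \<and> even (\<beta>' 0 + \<beta>' 1 + \<beta>' 2)
     then 1/4 * ?F (\<beta> 0, \<beta> 1, \<beta> 2) (\<beta>' 0, \<beta>' 1, \<beta>' 2) $$
       ((\<xi> 0 * b + \<xi> 1) * c + \<xi> 2, (\<xi>' 0 * b + \<xi>' 1) * c + \<xi>' 2) else 0)"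
    if "\<beta> \<in> bits" "\<beta>' \<in> bits" "\<xi> \<in> shields" "\<xi>' \<in> shields" for \<beta> \<beta>' \<xi> \<xi>'
    by (rule index_secret_sharing[OF _ _ _ _ F \<rho>_eq]) (use that bits less in auto)
  have even: "even (\<beta>0 0 + \<beta>0 1 + \<beta>0 2)" "even (\<beta>1 0 + \<beta>1 1 + \<beta>1 2)"
      "odd (mix \<beta>0 \<beta>1 0 + mix \<beta>0 \<beta>1 1 + mix \<beta>0 \<beta>1 2)" "odd (mix \<beta>1 \<beta>0 0 + mix \<beta>1 \<beta>0 1 + mix \<beta>1 \<beta>0 2)"
    using uvw by (auto simp: \<beta>0_def \<beta>1_def mix_def)
  have mem: "mix f g \<in> bits" if "f \<in> {\<beta>0, \<beta>1}" "g \<in> {\<beta>0, \<beta>1}" for f g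
    using that by (auto simp: bits_def)
  have mem': "mix f g \<in> shields" if "f \<in> {\<xi>0, \<xi>1}" "g \<in> {\<xi>0, \<xi>1}" for f g
    using that by (auto simp: shields_def)
  define r0 where "r0 = system_index a b c \<beta>0 \<xi>0"
  define r1 where "r1 = system_index a b c \<beta>1 \<xi>1"
  have member: "\<beta>0 \<in> bits" "\<beta>1 \<in> bits" "\<xi>0 \<in> shields" "\<xi>1 \<in> shields"
    using mem[of \<beta>0 \<beta>0] mem[of \<beta>1 \<beta>1] mem'[of \<xi>0 \<xi>0] mem'[of \<xi>1 \<xi>1] by (auto simp: same)
  have r: "r0 < 2 * 2 * 2 * a * b * c" "r1 < 2 * 2 * 2 * a * b * c"
    unfolding r0_def r1_def using system_index_less bits less member by blast+
  have q: "\<rho> $$ (r0, r1) \<noteq> 0"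
    unfolding r0_def r1_def \<rho>_entry[OF member] using even XY(3) by (simp add: \<xi>0(1) \<xi>1(1))
  \<comment> \<open>The label 000 keeps \<open>r0\<close> below \<open>a * b * c\<close>, whereas
    \<open>r1\<close> has a nonzero qubit label.\<close>
  have "r0 \<noteq> r1"
  proof -
    have "r0 < a * b * c" using less[OF member(3)] by (simp add: r0_def system_index_def \<beta>0_def)
    moreover have "1 * (a * b * c) \<le> (\<beta>1 0 * (2 * 2) + (\<beta>1 1 * 2 + \<beta>1 2)) * (a * b * c)"
      using uvw by (intro mult_right_mono) (auto simp: \<beta>1_def)
    ultimately show ?thesis unfolding r1_def system_index_def by linarith
  qed
  have carrier: "?M \<in> carrier_mat (2 * d u * ?n) (2 * d u * ?n)"
    using permute_systems_carrier[of "[2, 2, 2, a, b, c]" _ \<rho>] uvw by (auto simp: d_def mult_ac)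
  \<comment> \<open>A diagonal entry of a self-adjoint matrix is real.\<close>
  have diag: "\<rho> $$ (k, k) = complex_of_real (Re (\<rho> $$ (k, k)))" if "k < 2 * 2 * 2 * a * b * c" for k
    using psd_entries(1)[OF psd that that] by (auto simp: complex_eq_iff)
  show ?thesis
  proof (rule distillable_of_coherence[OF carrier, where ?i0.0 = "first \<beta>0 \<xi>0" and ?i1.0 = "first \<beta>1 \<xi>1"
        and ?j0.0 = "second \<beta>0 \<xi>0" and ?j1.0 = "second \<beta>1 \<xi>1"
        and p = "Re (\<rho> $$ (r0, r0))" and r = "Re (\<rho> $$ (r1, r1))" and q = "\<rho> $$ (r0, r1)"])
    show "first \<beta>0 \<xi>0 < 2 * d u" "first \<beta>1 \<xi>1 < 2 * d u"
      unfolding first_def using member bits shields neq by (auto intro!: mult_add_less)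
    show "second \<beta>0 \<xi>0 < ?n" "second \<beta>1 \<xi>1 < ?n"
      unfolding second_def using member bits shields neq
      by (intro mult_add_less[OF mult_add_less[OF mult_add_less]]; simp)+
    \<comment> \<open>The bit of \<open>u\<close> separates them, as the shield digit in
      \<open>\<xi>0\<close> is below \<open>d u\<close>.\<close>
    show "first \<beta>0 \<xi>0 \<noteq> first \<beta>1 \<xi>1"
      using \<xi>0(2)[OF \<open>u < 3\<close>] by (simp add: first_def \<beta>0_def \<beta>1_def)
    show "second \<beta>0 \<xi>0 \<noteq> second \<beta>1 \<xi>1"
    proof
      assume "second \<beta>0 \<xi>0 = second \<beta>1 \<xi>1"
      then have "\<xi>0 v * 2 * d w + \<xi>0 w = (\<xi>1 v * 2 + 1) * d w + \<xi>1 w"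
        using neq by (simp add: second_def \<beta>0_def \<beta>1_def)
      \<comment> \<open>Cancelling the last digit exposes the bit of \<open>w\<close>, and the two
        sides differ in parity.\<close>
      then have "\<xi>0 v * 2 = \<xi>1 v * 2 + 1"
        using \<xi>0(2)[OF \<open>w < 3\<close>] \<xi>1(2)[OF \<open>w < 3\<close>] by (rule mult_add_eqD)
      then show False by presburger
    qed
    show "?M $$ (first \<beta>0 \<xi>0 * ?n + second \<beta>0 \<xi>0, first \<beta>0 \<xi>0 * ?n + second \<beta>0 \<xi>0) = Re (\<rho> $$ (r0, r0))"
      "?M $$ (first \<beta>1 \<xi>1 * ?n + second \<beta>1 \<xi>1, first \<beta>1 \<xi>1 * ?n + second \<beta>1 \<xi>1) = Re (\<rho> $$ (r1, r1))"
      "?M $$ (first \<beta>0 \<xi>0 * ?n + second \<beta>0 \<xi>0, first \<beta>1 \<xi>1 * ?n + second \<beta>1 \<xi>1) = \<rho> $$ (r0, r1)"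
      "?M $$ (first \<beta>1 \<xi>1 * ?n + second \<beta>1 \<xi>1, first \<beta>0 \<xi>0 * ?n + second \<beta>0 \<xi>0) = cnj (\<rho> $$ (r0, r1))"
      using entry member diag[OF r(1)] diag[OF r(2)] psd_entries(1)[OF psd r]
      by (simp_all add: r0_def r1_def)
    show "\<rho> $$ (r0, r1) \<noteq> 0" by (rule q)
    show "2 * cmod (\<rho> $$ (r0, r1)) \<le> Re (\<rho> $$ (r0, r0)) + Re (\<rho> $$ (r1, r1))"
      by (rule psd_entries(2)[OF psd r \<open>r0 \<noteq> r1\<close>])
    fix x y
    assume x: "x \<in> {first \<beta>0 \<xi>0 * ?n + second \<beta>1 \<xi>1, first \<beta>1 \<xi>1 * ?n + second \<beta>0 \<xi>0}"
      and y: "y \<in> {first \<beta>0 \<xi>0 * ?n + second \<beta>0 \<xi>0, first \<beta>0 \<xi>0 * ?n + second \<beta>1 \<xi>1,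
        first \<beta>1 \<xi>1 * ?n + second \<beta>0 \<xi>0, first \<beta>1 \<xi>1 * ?n + second \<beta>1 \<xi>1}"
    \<comment> \<open>Such an \<open>x\<close> combines the bits of one triple at \<open>u\<close>
      with the other triple elsewhere, so its label is odd and its row and column vanish.\<close>
    obtain \<beta> \<xi> where x': "x = first \<beta> \<xi> * ?n + second \<beta> \<xi>" "\<beta> \<in> bits" "\<xi> \<in> shields"
        "odd (\<beta> 0 + \<beta> 1 + \<beta> 2)"
      using x even(3,4) mem mem' mix[of \<beta>0 \<beta>1 \<xi>0 \<xi>1] mix[of \<beta>1 \<beta>0 \<xi>1 \<xi>0]
      by (metis empty_iff insert_iff)
    obtain \<beta>' \<xi>' where y': "y = first \<beta>' \<xi>' * ?n + second \<beta>' \<xi>'" "\<beta>' \<in> bits" "\<xi>' \<in> shields"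
      using y mem mem' mix[of \<beta>0 \<beta>1 \<xi>0 \<xi>1] mix[of \<beta>1 \<beta>0 \<xi>1 \<xi>0] member
      by (metis empty_iff insert_iff)
    show "?M $$ (x, y) = 0 \<and> ?M $$ (y, x) = 0"
      unfolding x'(1) y'(1) using x'(2-4) y'(2,3) by (simp only: entry \<rho>_entry) simp
  qed
qed

theorem theorem3:
  fixes a b c :: nat and \<rho> :: "complex mat"
  assumes "secret_sharing_state a b c \<rho>"
  shows "distillable (2 * a) (2 * b * 2 * c)
           (permute_systems [2, 2, 2, a, b, c] [0, 3, 1, 4, 2, 5] \<rho>)
       \<and> distillable (2 * b) (2 * c * 2 * a)
           (permute_systems [2, 2, 2, a, b, c] [1, 4, 2, 5, 0, 3] \<rho>)
       \<and> distillable (2 * c) (2 * a * 2 * b)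
           (permute_systems [2, 2, 2, a, b, c] [2, 5, 0, 3, 1, 4] \<rho>)"
  \<comment> \<open>The splits are the three cyclic choices of the party standing alone.\<close>
  using distillable_split[OF assms, of 0 1 2] distillable_split[OF assms, of 1 2 0]
    distillable_split[OF assms, of 2 0 1]
  by (simp add: eval_nat_numeral)

end
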